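(* There is an asymptotic fully polynomial time approximation scheme (AFPTAS) for the bin packing type variant of the generalized extensible bin packing problem. That is, there exist a function $g$ and, for every $\varepsilon>0$, an algorithm that, given any instance $I$ of this variant with $\max_{i} f_i=1$, outputs a feasible solution of cost at most $(1+\varepsilon)\cdot cost(\mathrm{opt}(I))+g(1/\varepsilon)$, where $cost(\mathrm{opt}(I))$ is the minimum cost of a feasible solution of $I$, and whose running time is bounded by a polynomial in $1/\varepsilon$ and the length of the binary encoding of $I$.
   Context: Bin packing type variant of generalized extensible bin packing: an instance consists of $n$ jobs, where job $j$ has size $p_j\ge 0$, and $m$ machine types, where type $i\in\{1,\dots,m\}$ is given by three positive numbers $f_i$ (fixed cost), $c_i$ (standard capacity), $\sigma_i$ (cost per unit of overtime) satisfying $f_i=c_i\cdot\sigma_i$. A feasible solution first chooses, for every $i$, a non-negative integer number of machines of type $i$, and then assigns every job to one of the chosen machines. A chosen machine of type $i$ whose assigned jobs have total size (load) $L$ costs $cost_i(L)=f_i$ if $L\le c_i$, and $cost_i(L)=f_i+\sigma_i(L-c_i)$ otherwise. The cost of the solution is the sum of the costs of all chosen machines, and it is to be minimized. *)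

theory Defs
  imports Complex_Main "HOL-Library.Log_Nat" "HOL-Computational_Algebra.Polynomial"
begin

section \<open>Generalized extensible bin packing, bin packing type variant\<close>

text \<open>All numbers are rational, so that instances have a binary encoding.
  Jobs and machine types are the positions of the two lists, numbered from 0.\<close>

record mach_type =
  fixed_cost :: rat
  capacity :: rat
  overtime_rate :: rat

record packing_instance =
  jobs :: "rat list"
  mach_types :: "mach_type list"

definition valid_instance :: "packing_instance \<Rightarrow> bool" where
  "valid_instance I \<longleftrightarrow>
     (\<forall>p \<in> set (jobs I). p \<ge> 0) \<and>
     mach_types I \<noteq> [] \<and>
     (\<forall>T \<in> set (mach_types I).
        fixed_cost T > 0 \<and> capacity T > 0 \<and> overtime_rate T > 0 \<and>
        fixed_cost T = capacity T * overtime_rate T)"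

text \<open>\<open>counts S ! i\<close> is the number of chosen machines of type \<open>i\<close>; these machines are
  \<open>(i, 0), \<dots>, (i, counts S ! i - 1)\<close>. Job \<open>j\<close> is assigned to machine \<open>assigned S ! j\<close>.\<close>

record solution =
  counts :: "nat list"
  assigned :: "(nat \<times> nat) list"

definition feasible :: "packing_instance \<Rightarrow> solution \<Rightarrow> bool" where
  "feasible I S \<longleftrightarrow>
     length (counts S) = length (mach_types I) \<and>
     length (assigned S) = length (jobs I) \<and>
     (\<forall>(i, r) \<in> set (assigned S). i < length (mach_types I) \<and> r < counts S ! i)"

definition load :: "packing_instance \<Rightarrow> solution \<Rightarrow> nat \<times> nat \<Rightarrow> rat" where
  "load I S M = (\<Sum>j | j < length (jobs I) \<and> assigned S ! j = M. jobs I ! j)"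

definition machine_cost :: "mach_type \<Rightarrow> rat \<Rightarrow> rat" where
  "machine_cost T L =
     (if L \<le> capacity T then fixed_cost T
      else fixed_cost T + overtime_rate T * (L - capacity T))"

definition cost :: "packing_instance \<Rightarrow> solution \<Rightarrow> rat" where
  "cost I S =
     (\<Sum>i < length (mach_types I). \<Sum>r < counts S ! i.
        machine_cost (mach_types I ! i) (load I S (i, r)))"

definition opt :: "packing_instance \<Rightarrow> solution" where
  "opt I = (ARG_MIN (cost I) S. feasible I S)"

text \<open>There may be infinitely many feasible solutions, but the minimum is attained.\<close>

lemma machine_cost_ge:
  assumes "valid_instance I" "i < length (mach_types I)"
  shows "machine_cost (mach_types I ! i) L \<ge> fixed_cost (mach_types I ! i)"
proof -
  have "overtime_rate (mach_types I ! i) > 0"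
    using assms by (auto simp: valid_instance_def)
  then show ?thesis by (auto simp: machine_cost_def)
qed

lemma counts_cost_le:
  assumes "valid_instance I" "i < length (mach_types I)"
  shows "of_nat (counts S ! i) * fixed_cost (mach_types I ! i) \<le> cost I S"
proof -
  have nonneg: "0 \<le> machine_cost (mach_types I ! k) L" if "k < length (mach_types I)" for k L
  proof -
    have "fixed_cost (mach_types I ! k) > 0"
      using assms(1) that by (auto simp: valid_instance_def)
    then show ?thesis using machine_cost_ge[OF assms(1) that, of L] by linarith
  qed
  have "of_nat (counts S ! i) * fixed_cost (mach_types I ! i)
      = (\<Sum>r < counts S ! i. fixed_cost (mach_types I ! i))"
    by simp
  also have "\<dots> \<le> (\<Sum>r < counts S ! i. machine_cost (mach_types I ! i) (load I S (i, r)))"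
    by (intro sum_mono machine_cost_ge assms)
  also have "\<dots> \<le> cost I S"
    unfolding cost_def
    by (rule member_le_sum[of i _ "\<lambda>i. \<Sum>r < counts S ! i.
          machine_cost (mach_types I ! i) (load I S (i, r))"])
       (use assms nonneg in \<open>auto intro!: sum_nonneg\<close>)
  finally show ?thesis .
qed

lemma finite_feasible_cost_le:
  assumes "valid_instance I"
  shows "finite {S. feasible I S \<and> cost I S \<le> C}"
proof -
  let ?m = "length (mach_types I)"
  define K where "K = (\<Sum>T\<leftarrow>mach_types I. nat \<lceil>C / fixed_cost T\<rceil>)"
  have K: "counts S ! i \<le> K" if "cost I S \<le> C" "i < ?m" for S i
  proof -
    let ?T = "mach_types I ! i"
    have pos: "fixed_cost ?T > 0"
      using assms that by (auto simp: valid_instance_def)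
    have "of_nat (counts S ! i) * fixed_cost ?T \<le> C"
      using counts_cost_le[OF assms that(2), of S] that(1) by linarith
    then have "of_nat (counts S ! i) \<le> C / fixed_cost ?T"
      using pos by (simp add: pos_le_divide_eq)
    then have "counts S ! i \<le> nat \<lceil>C / fixed_cost ?T\<rceil>"
      by linarith
    also have "\<dots> \<le> K"
      unfolding K_def using that(2) by (intro member_le_sum_list) auto
    finally show ?thesis .
  qed
  let ?A = "{xs. set xs \<subseteq> {..K} \<and> length xs = ?m}"
  let ?B = "{xs. set xs \<subseteq> {..<?m} \<times> {..<K} \<and> length xs = length (jobs I)}"
  have "{S. feasible I S \<and> cost I S \<le> C}
      \<subseteq> (\<lambda>(x, y). \<lparr>counts = x, assigned = y\<rparr>) ` (?A \<times> ?B)"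
  proof
    fix S assume S: "S \<in> {S. feasible I S \<and> cost I S \<le> C}"
    have "counts S \<in> ?A"
      using S K[of S] by (auto simp: feasible_def in_set_conv_nth)
    moreover have "assigned S \<in> ?B"
      using S K[of S] by (fastforce simp: feasible_def)
    moreover have "S = \<lparr>counts = counts S, assigned = assigned S\<rparr>"
      by simp
    ultimately show "S \<in> (\<lambda>(x, y). \<lparr>counts = x, assigned = y\<rparr>) ` (?A \<times> ?B)"
      by force
  qed
  moreover have "finite (?A \<times> ?B)"
    by (intro finite_cartesian_product finite_lists_length_eq) auto
  ultimately show ?thesis
    by (meson finite_imageI finite_subset)
qed

lemma opt_is_arg_min:
  assumes "valid_instance I"
  shows "is_arg_min (cost I) (feasible I) (opt I)"
proof -
  let ?S0 = "\<lparr>counts = replicate (length (mach_types I)) 1,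
              assigned = replicate (length (jobs I)) (0, 0)\<rparr>"
  have feas: "feasible I ?S0"
    using assms by (auto simp: feasible_def valid_instance_def)
  let ?A = "{S. feasible I S \<and> cost I S \<le> cost I ?S0}"
  have "?S0 \<in> ?A" using feas by simp
  then obtain S where "is_arg_min (cost I) (\<lambda>S. S \<in> ?A) S"
    using ex_is_arg_min_if_finite[OF finite_feasible_cost_le[OF assms]] by blast
  then have "is_arg_min (cost I) (feasible I) S"
    unfolding is_arg_min_linorder by (smt (verit) mem_Collect_eq order.trans linorder_linear)
  then show ?thesis
    unfolding opt_def arg_min_def by (rule someI)
qed

corollary feasible_opt: "valid_instance I \<Longrightarrow> feasible I (opt I)"
  and cost_opt_le: "valid_instance I \<Longrightarrow> feasible I S \<Longrightarrow> cost I (opt I) \<le> cost I S"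
  using opt_is_arg_min[of I] unfolding is_arg_min_linorder by auto

section \<open>Algorithms and their running time\<close>

text \<open>Algorithms are programs of a first-order functional language over binary trees with
  integer leaves, under the logarithmic cost criterion: no operation is free, and each
  evaluation step costs the number of symbols of the value it yields. The operands of an
  operation are charged when they are evaluated. Hence the total size of all data occurring
  during an evaluation is at most its cost, and as all basic operations are computable in
  polynomial time, the running time agrees with that of Turing machines up to a polynomial.\<close>

datatype val = VInt int | VPair val val

text \<open>The length of a value written in prefix notation over an alphabet of five symbols:
  a pair is one symbol followed by its components, an integer is a sign followed by its
  binary digits (none for 0).\<close>

fun val_size :: "val \<Rightarrow> nat" where
  "val_size (VInt k) = 1 + floorlog 2 (nat \<bar>k\<bar>)"
| "val_size (VPair v w) = 1 + val_size v + val_size w"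

datatype arith_op = Add | Sub | Mul | Div | Less

fun arith :: "arith_op \<Rightarrow> int \<Rightarrow> int \<Rightarrow> int" where
  "arith Add a b = a + b"
| "arith Sub a b = a - b"
| "arith Mul a b = a * b"
| "arith Div a b = a div b"
| "arith Less a b = (if a < b then 1 else 0)"

text \<open>\<open>Var n\<close> is the \<open>n\<close>-th innermost bound variable (de Bruijn index). In \<open>Bind e b\<close>, the value
  of \<open>e\<close> is bound in \<open>b\<close>. \<open>Call f e\<close> calls the \<open>f\<close>-th function of the program, whose body has
  the argument as its only free variable. \<open>IfNonzero\<close> takes the first branch unless the
  condition is 0.\<close>

datatype expr =
    Var nat
  | Lit int
  | Arith arith_op expr expr
  | MkPair expr expr
  | First expr
  | Second expr
  | IsPair expr
  | IfNonzero expr expr expr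
  | Bind expr expr
  | Call nat expr

type_synonym program = "expr list"

text \<open>\<open>eval P env e v t\<close>: in the environment \<open>env\<close>, the expression \<open>e\<close> evaluates to \<open>v\<close> in
  time \<open>t\<close>. Ill-typed and diverging evaluations yield no value.\<close>

inductive eval :: "program \<Rightarrow> val list \<Rightarrow> expr \<Rightarrow> val \<Rightarrow> nat \<Rightarrow> bool" for P where
  eval_Var: "n < length env \<Longrightarrow> eval P env (Var n) (env ! n) (val_size (env ! n))"
| eval_Lit: "eval P env (Lit k) (VInt k) (val_size (VInt k))"
| eval_Arith: "eval P env e (VInt a) t \<Longrightarrow> eval P env e' (VInt b) t' \<Longrightarrow> v = VInt (arith f a b) \<Longrightarrow>
    eval P env (Arith f e e') v (t + t' + val_size v)"
| eval_MkPair: "eval P env e v t \<Longrightarrow> eval P env e' v' t' \<Longrightarrow>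
    eval P env (MkPair e e') (VPair v v') (t + t' + val_size (VPair v v'))"
| eval_First: "eval P env e (VPair v v') t \<Longrightarrow> eval P env (First e) v (t + val_size v)"
| eval_Second: "eval P env e (VPair v v') t \<Longrightarrow> eval P env (Second e) v' (t + val_size v')"
| eval_IsPair: "eval P env e v t \<Longrightarrow> w = VInt (case v of VPair _ _ \<Rightarrow> 1 | VInt _ \<Rightarrow> 0) \<Longrightarrow>
    eval P env (IsPair e) w (t + val_size w)"
| eval_IfNonzero: "eval P env c (VInt k) t \<Longrightarrow> eval P env (if k \<noteq> 0 then e else e') v t' \<Longrightarrow>
    eval P env (IfNonzero c e e') v (t + t' + val_size v)"
| eval_Bind: "eval P env e v t \<Longrightarrow> eval P (v # env) b w t' \<Longrightarrow>
    eval P env (Bind e b) w (t + t' + val_size w)"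
| eval_Call: "eval P env e v t \<Longrightarrow> f < length P \<Longrightarrow> eval P [v] (P ! f) w t' \<Longrightarrow>
    eval P env (Call f e) w (t + t' + val_size w)"

text \<open>A program is started by calling its function 0.\<close>

definition runs :: "program \<Rightarrow> val \<Rightarrow> val \<Rightarrow> nat \<Rightarrow> bool" where
  "runs P v w t \<longleftrightarrow> eval P [v] (Call 0 (Var 0)) w t"

lemma eval_deterministic:
  "eval P env e v t \<Longrightarrow> eval P env e v' t' \<Longrightarrow> v' = v \<and> t' = t"
proof (induction arbitrary: v' t' rule: eval.induct)
  case (eval_Var n env)
  then show ?case by (auto elim: eval.cases)
next
  case (eval_Lit env k)
  then show ?case by (auto elim: eval.cases)
next
  case (eval_Arith env e a t e2 b t2 v f)
  from eval_Arith.prems show ?case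
    by (cases rule: eval.cases) (use eval_Arith in \<open>force dest: eval_Arith.IH\<close>)
next
  case (eval_MkPair env e v t e2 v2 t2)
  from eval_MkPair.prems show ?case
    by (cases rule: eval.cases) (force dest: eval_MkPair.IH)
next
  case (eval_First env e v v2 t)
  from eval_First.prems show ?case
    by (cases rule: eval.cases) (force dest: eval_First.IH)
next
  case (eval_Second env e v v2 t)
  from eval_Second.prems show ?case
    by (cases rule: eval.cases) (force dest: eval_Second.IH)
next
  case (eval_IsPair env e v t w)
  from eval_IsPair.prems show ?case
    by (cases rule: eval.cases) (use eval_IsPair in \<open>force dest: eval_IsPair.IH\<close>)
next
  case (eval_IfNonzero env c k t e e2 v t2)
  from eval_IfNonzero.prems show ?case
    by (cases rule: eval.cases) (use eval_IfNonzero.IH in \<open>blast+\<close>)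
next
  case (eval_Bind env e v t b w t2)
  from eval_Bind.prems show ?case
    by (cases rule: eval.cases) (use eval_Bind.IH in \<open>blast+\<close>)
next
  case (eval_Call env e v t f w t2)
  from eval_Call.prems show ?case
    by (cases rule: eval.cases) (use eval_Call.IH in \<open>blast+\<close>)
qed

corollary runs_deterministic: "runs P v w t \<Longrightarrow> runs P v w' t' \<Longrightarrow> w' = w \<and> t' = t"
  unfolding runs_def by (rule eval_deterministic)

section \<open>Binary encodings\<close>

definition enc_nat :: "nat \<Rightarrow> val" where
  "enc_nat n = VInt (int n)"

text \<open>Numerator and denominator in lowest terms.\<close>

definition enc_rat :: "rat \<Rightarrow> val" where
  "enc_rat x = VPair (VInt (fst (quotient_of x))) (VInt (snd (quotient_of x)))"

fun enc_list :: "('a \<Rightarrow> val) \<Rightarrow> 'a list \<Rightarrow> val" where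
  "enc_list f [] = VInt 0"
| "enc_list f (x # xs) = VPair (f x) (enc_list f xs)"

definition enc_mach_type :: "mach_type \<Rightarrow> val" where
  "enc_mach_type T =
     VPair (enc_rat (fixed_cost T)) (VPair (enc_rat (capacity T)) (enc_rat (overtime_rate T)))"

definition enc_instance :: "packing_instance \<Rightarrow> val" where
  "enc_instance I = VPair (enc_list enc_rat (jobs I)) (enc_list enc_mach_type (mach_types I))"

definition enc_solution :: "solution \<Rightarrow> val" where
  "enc_solution S =
     VPair (enc_list enc_nat (counts S))
           (enc_list (\<lambda>(i, r). VPair (enc_nat i) (enc_nat r)) (assigned S))"

abbreviation encoding_length :: "packing_instance \<Rightarrow> nat" where
  "encoding_length I \<equiv> val_size (enc_instance I)"

lemma inj_enc_list:
  assumes "inj f"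
  shows "inj (enc_list f)"
proof (rule injI)
  show "xs = ys" if "enc_list f xs = enc_list f ys" for xs ys
    using that
  proof (induction xs arbitrary: ys)
    case Nil
    then show ?case by (cases ys) auto
  next
    case (Cons x xs)
    then show ?case using injD[OF assms] by (cases ys) auto
  qed
qed

lemma inj_enc_rat: "inj enc_rat"
  by (auto intro!: injI simp: enc_rat_def prod_eq_iff simp flip: quotient_of_inject_eq)

lemma inj_enc_instance: "inj enc_instance"
proof -
  have "inj enc_mach_type"
    by (rule injI)
      (auto simp: enc_mach_type_def intro!: mach_type.equality dest: injD[OF inj_enc_rat])
  then show ?thesis
    by (intro injI)
      (auto simp: enc_instance_def intro!: packing_instance.equality
         dest: injD[OF inj_enc_list] injD[OF inj_enc_list[OF inj_enc_rat]])
qed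

lemma inj_enc_solution: "inj enc_solution"
proof -
  have "inj enc_nat" "inj (\<lambda>(i, r). VPair (enc_nat i) (enc_nat r))"
    by (auto intro!: injI simp: enc_nat_def)
  then show ?thesis
    by (intro injI) (auto simp: enc_solution_def intro!: solution.equality dest!: injD[OF inj_enc_list, rotated])
qed

end

theory Submission
  imports Defs
begin

text \<open>Since \<open>f\<^sub>i = c\<^sub>i \<sigma>\<^sub>i\<close>, a machine of type \<open>i\<close> with load \<open>L\<close> costs \<open>max f\<^sub>i (\<sigma>\<^sub>i L)\<close>. Hence every
  solution costs at least \<open>\<sigma>\<close> times the total size of the jobs, where \<open>\<sigma>\<close> is the least overtime
  rate. Putting all jobs on a single machine with overtime rate \<open>\<sigma>\<close> exceeds this bound by at most
  the fixed cost of that machine, which is at most 1. So \<open>g = 1\<close> works, and neither the algorithm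
  nor its running time depends on \<open>\<epsilon>\<close>.\<close>

section \<open>Machines of least overtime rate\<close>

text \<open>The head is compared with the winner of the tail, exactly as
  \<open>cheapest_body\<close> does, so the program is verified by induction along this recursion.
  Ties go to the head.\<close>

fun cheapest :: "mach_type list \<Rightarrow> nat" where
  "cheapest (T # U # Ts) =
     (let i = cheapest (U # Ts)
      in if overtime_rate ((U # Ts) ! i) < overtime_rate T then Suc i else 0)"
| "cheapest _ = 0"

lemma cheapest_less: "Ts \<noteq> [] \<Longrightarrow> cheapest Ts < length Ts"
  by (induction Ts rule: cheapest.induct) (auto simp: Let_def)

lemma overtime_rate_cheapest_le:
  "T \<in> set Ts \<Longrightarrow> overtime_rate (Ts ! cheapest Ts) \<le> overtime_rate T"
proof (induction Ts arbitrary: T rule: cheapest.induct)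
  case (1 T' U Ts)
  have "overtime_rate ((U # Ts) ! cheapest (U # Ts)) \<le> overtime_rate V" if "V \<in> set (U # Ts)" for V
    using 1(1) that by blast
  then show ?case using 1(2) by (fastforce simp: Let_def)
qed auto

text \<open>The index is an integer because the program decrements it at every entry. Past the
  marked position it is negative and never matches again, so no second test is necessary.\<close>

definition indicator_list :: "nat \<Rightarrow> int \<Rightarrow> nat list" where
  "indicator_list n i = map (\<lambda>k. if int k = i then 1 else 0) [0..<n]"

lemma length_indicator_list [simp]: "length (indicator_list n i) = n"
  by (simp add: indicator_list_def)

lemma nth_indicator_list [simp]:
  "k < n \<Longrightarrow> indicator_list n i ! k = (if int k = i then 1 else 0)"
  by (simp add: indicator_list_def)

lemma indicator_list_0 [simp]: "indicator_list 0 i = []"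
  by (simp add: indicator_list_def)

lemma indicator_list_Suc [simp]:
  "indicator_list (Suc n) i = (if i = 0 then 1 else 0) # indicator_list n (i - 1)"
  by (auto simp: indicator_list_def map_upt_Suc algebra_simps simp del: upt_Suc)

definition single_machine :: "packing_instance \<Rightarrow> solution" where
  "single_machine I =
     (let i = cheapest (mach_types I)
      in \<lparr>counts = indicator_list (length (mach_types I)) (int i),
          assigned = replicate (length (jobs I)) (i, 0)\<rparr>)"

lemma feasible_single_machine: "valid_instance I \<Longrightarrow> feasible I (single_machine I)"
  using cheapest_less[of "mach_types I"]
  by (auto simp: feasible_def single_machine_def Let_def valid_instance_def)

section \<open>Comparison of the single machine with the optimum\<close>

lemma machine_cost_eq_max:
  assumes "valid_instance I" "i < length (mach_types I)"
  shows "machine_cost (mach_types I ! i) L =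
    max (fixed_cost (mach_types I ! i)) (overtime_rate (mach_types I ! i) * L)"
proof -
  let ?T = "mach_types I ! i"
  have "?T \<in> set (mach_types I)" using assms(2) by simp
  then have *: "fixed_cost ?T = overtime_rate ?T * capacity ?T" "overtime_rate ?T > 0"
    using assms(1) by (auto simp: valid_instance_def)
  \<comment> \<open>For positive rate, \<open>L \<le> capacity\<close> is the same as
    \<open>rate * L \<le> fixed_cost\<close>, and above capacity the terms \<open>fixed_cost\<close>
    and \<open>rate * capacity\<close> cancel.\<close>
  then show ?thesis
    by (auto simp: machine_cost_def max_def algebra_simps)
qed

lemma sum_load:
  assumes "feasible I S"
  shows "(\<Sum>i < length (mach_types I). \<Sum>r < counts S ! i. load I S (i, r)) = sum_list (jobs I)"
proof -
  let ?M = "Sigma {..<length (mach_types I)} (\<lambda>i. {..<counts S ! i})"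
  have "(\<Sum>i < length (mach_types I). \<Sum>r < counts S ! i. load I S (i, r)) = (\<Sum>M\<in>?M. load I S M)"
    by (simp add: sum.Sigma)
  also have "\<dots> = (\<Sum>M\<in>?M. \<Sum>j | j \<in> {..<length (jobs I)} \<and> assigned S ! j = M. jobs I ! j)"
    by (simp add: load_def)
  also have "\<dots> = (\<Sum>j<length (jobs I). jobs I ! j)"
  \<comment> \<open>The jobs are grouped by machine; feasibility guarantees that every job falls
    into one of the groups.\<close>
  proof (rule sum.group)
    show "(!) (assigned S) ` {..<length (jobs I)} \<subseteq> ?M"
    proof
      fix M assume "M \<in> (!) (assigned S) ` {..<length (jobs I)}"
      then have "M \<in> set (assigned S)" using assms by (auto simp: feasible_def)
      then show "M \<in> ?M" using assms by (auto simp: feasible_def)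
    qed
  qed auto
  finally show ?thesis by (simp add: sum_list_sum_nth atLeast0LessThan)
qed

text \<open>Each machine costs at least its rate times its nonnegative load. Taking the least rate
  for \<open>s\<close> bounds the optimum from below; taking \<open>s = 0\<close> shows that costs
  are nonnegative.\<close>

lemma sum_jobs_le_cost:
  assumes "valid_instance I" "feasible I S"
    and s: "\<And>T. T \<in> set (mach_types I) \<Longrightarrow> s \<le> overtime_rate T"
  shows "s * sum_list (jobs I) \<le> cost I S"
proof -
  have nonneg: "0 \<le> load I S M" for M
    using assms(1) by (auto simp: load_def valid_instance_def intro!: sum_nonneg)
  have "s * sum_list (jobs I) =
      (\<Sum>i < length (mach_types I). \<Sum>r < counts S ! i. s * load I S (i, r))"
    by (simp add: sum_load[OF assms(2), symmetric] sum_distrib_left)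
  also have "\<dots> \<le> cost I S"
    unfolding cost_def using nonneg s
    by (intro sum_mono) (simp add: machine_cost_eq_max[OF assms(1)] le_max_iff_disj mult_right_mono)
  finally show ?thesis .
qed

lemma cost_single_machine:
  assumes "valid_instance I" and le1: "\<And>T. T \<in> set (mach_types I) \<Longrightarrow> fixed_cost T \<le> 1"
  shows "cost I (single_machine I) \<le> cost I (opt I) + 1"
proof -
  define i where "i = cheapest (mach_types I)"
  let ?T = "mach_types I ! i" and ?S = "single_machine I"
  have i: "i < length (mach_types I)"
    using assms cheapest_less by (auto simp: i_def valid_instance_def)
  have c: "counts ?S ! k = (if k = i then 1 else 0)" if "k < length (mach_types I)" for k
    using that by (simp add: single_machine_def Let_def i_def)
  have "load I ?S (i, 0) = sum_list (jobs I)"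
    by (simp add: load_def single_machine_def Let_def i_def sum_list_sum_nth atLeast0LessThan
          lessThan_def cong: conj_cong)
  moreover have "cost I ?S = machine_cost ?T (load I ?S (i, 0))"
  proof -
    have "cost I ?S = (\<Sum>k < length (mach_types I).
        if k = i then machine_cost ?T (load I ?S (i, 0)) else 0)"
      unfolding cost_def by (intro sum.cong) (auto simp: c)
    then show ?thesis using i by simp
  qed
  ultimately have "cost I ?S = max (fixed_cost ?T) (overtime_rate ?T * sum_list (jobs I))"
    using machine_cost_eq_max[OF assms(1) i] by simp
  moreover have "overtime_rate ?T * sum_list (jobs I) \<le> cost I (opt I)"
    using sum_jobs_le_cost[OF assms(1) feasible_opt[OF assms(1)]] overtime_rate_cheapest_le
    by (simp add: i_def)
  \<comment> \<open>This settles the case where the fixed cost is the maximum: the optimum is then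
    still at least 0, so a fixed cost of at most 1 stays within the bound.\<close>
  moreover have "0 \<le> overtime_rate ?T * sum_list (jobs I)"
    using assms(1) nth_mem[OF i]
    by (auto simp: valid_instance_def intro!: mult_nonneg_nonneg sum_list_nonneg
          dest!: bspec[where x = ?T])
  moreover have "fixed_cost ?T \<le> 1" using le1 i by simp
  ultimately show ?thesis by linarith
qed

section \<open>Sizes of values\<close>

lemma floorlog_2_0 [simp]: "floorlog 2 0 = 0"
  and floorlog_2_1 [simp]: "floorlog 2 (Suc 0) = 1"
  by (simp_all add: floorlog_def)

lemma val_size_0 [simp]: "val_size (VInt 0) = 1"
  and val_size_1 [simp]: "val_size (VInt 1) = 2"
  by simp_all

lemma less_two_power_floorlog: "n < 2 ^ floorlog 2 n"
  using floorlog_leD[of 2 n "floorlog 2 n"] by simp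

text \<open>Numbers below \<open>2 ^ x\<close> and \<open>2 ^ y\<close> have a product below
  \<open>2 ^ (x + y)\<close>. This controls the cross products that arise when two rates are
  compared.\<close>

lemma val_size_mult: "val_size (VInt (a * b)) \<le> val_size (VInt a) + val_size (VInt b)"
proof -
  have "nat \<bar>a * b\<bar> < 2 ^ (floorlog 2 (nat \<bar>a\<bar>) + floorlog 2 (nat \<bar>b\<bar>))"
    unfolding abs_mult nat_mult_distrib[OF abs_ge_zero] power_add
    by (intro mult_strict_mono less_two_power_floorlog) auto
  then have "floorlog 2 (nat \<bar>a * b\<bar>) \<le> floorlog 2 (nat \<bar>a\<bar>) + floorlog 2 (nat \<bar>b\<bar>)"
    by (intro floorlog_leI) auto
  then show ?thesis by simp
qed

text \<open>A linear instead of a logarithmic bound suffices, since it is applied only to type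
  indices and counters, whose absolute values are bounded by encoding lengths.\<close>

lemma val_size_le_abs: "val_size (VInt k) \<le> 1 + nat \<bar>k\<bar>"
proof -
  have "nat \<bar>k\<bar> < 2 ^ nat \<bar>k\<bar>" by (rule less_exp)
  then have "floorlog 2 (nat \<bar>k\<bar>) \<le> nat \<bar>k\<bar>" by (intro floorlog_leI) auto
  then show ?thesis by simp
qed

lemma length_less_val_size_enc_list: "length xs < val_size (enc_list f xs)"
  by (induction xs) auto

lemma val_size_indicator_list: "val_size (enc_list enc_nat (indicator_list n i)) \<le> 3 * n + 1"
proof (induction n arbitrary: i)
  case (Suc n)
  \<comment> \<open>An entry takes at most 3 symbols: one for the pair and at most two for 0 or 1.
    The instance at \<open>- 1\<close> is what \<open>i - 1\<close> becomes when
    \<open>i = 0\<close>.\<close>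
  show ?case using Suc[of "i - 1"] Suc[of "- 1"] by (simp add: enc_nat_def)
qed simp

lemma val_size_replicate: "val_size (enc_list f (replicate n x)) = n * (1 + val_size (f x)) + 1"
  by (induction n) auto

section \<open>The algorithm\<close>

text \<open>Below the \<open>Bind\<close>, \<open>Var 0\<close> is the index of the chosen type and
  \<open>Var 1\<close> the instance; \<open>First\<close> drops the rate returned along with the
  index.\<close>

definition main_body :: expr where
  "main_body =
     Bind (First (Call 1 (Second (Var 0))))
       (MkPair (Call 2 (MkPair (Second (Var 1)) (Var 0)))
               (Call 3 (MkPair (First (Var 1)) (Var 0))))"

text \<open>The recursive call yields \<open>(i, (a, b))\<close>, where \<open>a/b\<close> is the least overtime rate in the tail of
  the list, attained at \<open>i\<close>. If the first rate is \<open>c/d\<close>, then \<open>a/b < c/d\<close> means \<open>a d < b c\<close>.\<close>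

definition cheapest_body :: expr where
  "cheapest_body =
     IfNonzero (IsPair (Second (Var 0)))
       (Bind (Call 1 (Second (Var 0)))
         (Bind (Second (Second (First (Var 1))))
           (IfNonzero
             (Arith Less
               (Arith Mul (First (Second (Var 1))) (Second (Var 0)))
               (Arith Mul (Second (Second (Var 1))) (First (Var 0))))
             (MkPair (Arith Add (First (Var 1)) (Lit 1)) (Second (Var 1)))
             (MkPair (Lit 0) (Var 0)))))
       (MkPair (Lit 0) (Second (Second (First (Var 0)))))"

text \<open>The argument pairs the remaining types with a counter that hits 0 at the chosen type.
  The final \<open>Lit 0\<close> is the encoding of the empty list, which \<open>IsPair\<close>
  tells apart from a nonempty one.\<close>

definition counts_body :: expr where
  "counts_body =
     IfNonzero (IsPair (First (Var 0)))
       (MkPair (IfNonzero (Second (Var 0)) (Lit 0) (Lit 1))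
         (Call 2 (MkPair (Second (First (Var 0))) (Arith Sub (Second (Var 0)) (Lit 1)))))
       (Lit 0)"

definition assigned_body :: expr where
  "assigned_body =
     IfNonzero (IsPair (First (Var 0)))
       (MkPair (MkPair (Second (Var 0)) (Lit 0))
         (Call 3 (MkPair (Second (First (Var 0))) (Second (Var 0)))))
       (Lit 0)"

definition single_machine_program :: program where
  "single_machine_program = [main_body, cheapest_body, counts_body, assigned_body]"

section \<open>Rules for symbolic evaluation\<close>

lemma eval_leI: "eval P env e v t \<Longrightarrow> t \<le> T \<Longrightarrow> \<exists>t\<le>T. eval P env e v t"
  by blast

lemma eval_Vars:
  "eval P (x # env) (Var 0) x (val_size x)"
  "eval P (x # y # env) (Var 1) y (val_size y)"
  using eval_Var[of 0 "x # env"] eval_Var[of 1 "x # y # env"] by simp_all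

lemma eval_Ariths:
  assumes "eval P env e (VInt a) t" "eval P env e' (VInt b) t'"
  shows
    "eval P env (Arith Add e e') (VInt (a + b)) (t + t' + val_size (VInt (a + b)))"
    "eval P env (Arith Sub e e') (VInt (a - b)) (t + t' + val_size (VInt (a - b)))"
    "eval P env (Arith Mul e e') (VInt (a * b)) (t + t' + val_size (VInt (a * b)))"
    "eval P env (Arith Less e e') (VInt (if a < b then 1 else 0))
      (t + t' + val_size (VInt (if a < b then 1 else 0)))"
  by (rule eval_Arith[OF assms]; simp)+

lemma eval_If_True:
  "eval P env c (VInt k) t \<Longrightarrow> eval P env e v t' \<Longrightarrow> k \<noteq> 0 \<Longrightarrow>
    eval P env (IfNonzero c e e') v (t + t' + val_size v)"
  by (rule eval_IfNonzero) auto

lemma eval_If_False: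
  "eval P env c (VInt k) t \<Longrightarrow> eval P env e' v t' \<Longrightarrow> k = 0 \<Longrightarrow>
    eval P env (IfNonzero c e e') v (t + t' + val_size v)"
  by (rule eval_IfNonzero) auto

lemma eval_Calls:
  assumes "eval single_machine_program env e v t"
  shows
    "eval single_machine_program [v] main_body w t' \<Longrightarrow>
       eval single_machine_program env (Call 0 e) w (t + t' + val_size w)"
    "eval single_machine_program [v] cheapest_body w t' \<Longrightarrow>
       eval single_machine_program env (Call 1 e) w (t + t' + val_size w)"
    "eval single_machine_program [v] counts_body w t' \<Longrightarrow>
       eval single_machine_program env (Call 2 e) w (t + t' + val_size w)"
    "eval single_machine_program [v] assigned_body w t' \<Longrightarrow>
       eval single_machine_program env (Call 3 e) w (t + t' + val_size w)"
  using assms by (auto intro!: eval_Call simp: single_machine_program_def numeral_eq_Suc)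

lemmas eval_straight = eval_Vars eval_Lit eval_Ariths eval_MkPair eval_First eval_Second
  eval_IsPair[OF _ refl] eval_Bind

section \<open>Correctness and running time of the functions\<close>

text \<open>The entries of the list are never inspected, so \<open>f\<close> is arbitrary. Each of
  the \<open>length xs + 1\<close> calls makes a constant number of steps on values of size linear
  in \<open>B\<close>; the factor 40 is a coarse count of these.\<close>

lemma eval_assigned:
  assumes "val_size (enc_list f xs) \<le> B" "val_size v \<le> B"
    "val_size (enc_list g (replicate (length xs) y)) \<le> B"
    and y: "g y = VPair v (VInt 0)"
  shows "\<exists>t \<le> (length xs + 1) * (40 * B).
    eval single_machine_program [VPair (enc_list f xs) v] assigned_body
      (enc_list g (replicate (length xs) y)) t"
  using assms(1-3)
proof (induction xs)
  case Nil
  show ?case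
    unfolding assigned_body_def enc_list.simps list.size replicate.simps
    \<comment> \<open>The time stays schematic while the evaluation rules build it up; only the
      resulting sum is compared with the bound.\<close>
    apply (rule eval_leI)
     apply (rule eval_If_False eval_straight | (simp; fail))+
    using Nil by simp
next
  case (Cons x xs)
  then obtain t where t:
      "eval single_machine_program [VPair (enc_list f xs) v] assigned_body
      (enc_list g (replicate (length xs) y)) t"
      "t \<le> (length xs + 1) * (40 * B)" by auto
  show ?case
    apply (subst assigned_body_def)
    unfolding enc_list.simps list.size replicate.simps add_Suc_right add_0_right y
    apply (rule eval_leI)
     apply (rule eval_If_True eval_straight eval_Calls t(1) | (simp; fail))+
    using t(2) Cons.prems y
    by (simp add: algebra_simps)
qed

text \<open>The sum of \<open>nat \<bar>i\<bar>\<close> and the list length is bounded because it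
  never grows: a call may increase the former by 1, but shortens the list by 1.\<close>

lemma eval_counts:
  assumes "val_size (enc_list f xs) \<le> B" "nat \<bar>i\<bar> + length xs \<le> B"
    "val_size (enc_list enc_nat (indicator_list (length xs) i)) \<le> B"
  shows "\<exists>t \<le> (length xs + 1) * (60 * B).
    eval single_machine_program [VPair (enc_list f xs) (VInt i)] counts_body
      (enc_list enc_nat (indicator_list (length xs) i)) t"
  using assms
proof (induction xs arbitrary: i)
  case Nil
  show ?case
    unfolding counts_body_def enc_list.simps list.size indicator_list_0
    apply (rule eval_leI)
     apply (rule eval_If_False eval_straight | (simp; fail))+
    using Nil val_size_le_abs[of i] by simp
next
  case (Cons x xs)
  have "val_size (enc_list enc_nat (indicator_list (length xs) (i - 1))) \<le> B"
    "nat \<bar>i - 1\<bar> + length xs \<le> B"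
    using Cons.prems(2,3) by auto
  then obtain t where t:
      "eval single_machine_program [VPair (enc_list f xs) (VInt (i - 1))] counts_body
      (enc_list enc_nat (indicator_list (length xs) (i - 1))) t"
      "t \<le> (length xs + 1) * (60 * B)" using Cons.IH[of "i - 1"] Cons.prems by auto
  have size: "val_size (VInt i) \<le> 1 + B" "val_size (VInt (i - 1)) \<le> 1 + B"
    using Cons.prems(2) val_size_le_abs[of i] val_size_le_abs[of "i - 1"]
    by (simp_all del: val_size.simps)
  \<comment> \<open>The entry is evaluated separately, since its branch depends on whether
    \<open>i = 0\<close>. Below, \<open>t'(1)\<close> precedes the conditional rules, so that this
    inner conditional is not taken apart again.\<close>
  obtain t' where t': "eval single_machine_program [VPair (VPair (f x) (enc_list f xs)) (VInt i)]
      (IfNonzero (Second (Var 0)) (Lit 0) (Lit 1)) (enc_nat (if i = 0 then 1 else 0)) t'"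
    "t' \<le> 3 * B + 20"
  proof (cases "i = 0")
    case True
    have "\<exists>t \<le> 3 * B + 20.
      eval single_machine_program [VPair (VPair (f x) (enc_list f xs)) (VInt i)]
        (IfNonzero (Second (Var 0)) (Lit 0) (Lit 1)) (VInt 1) t"
      apply (rule eval_leI)
       apply (rule eval_If_False eval_straight | (simp add: True; fail))+
      using Cons.prems size by simp
    then show ?thesis using that True by (auto simp: enc_nat_def)
  next
    case False
    have "\<exists>t \<le> 3 * B + 20.
      eval single_machine_program [VPair (VPair (f x) (enc_list f xs)) (VInt i)]
        (IfNonzero (Second (Var 0)) (Lit 0) (Lit 1)) (VInt 0) t"
      apply (rule eval_leI)
       apply (rule eval_If_True eval_straight | (simp add: False; fail))+
      using Cons.prems size by simp
    then show ?thesis using that False by (auto simp: enc_nat_def)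
  qed
  show ?case
    apply (subst counts_body_def)
    unfolding enc_list.simps list.size indicator_list_Suc add_Suc_right add_0_right
    apply (rule eval_leI)
     apply (rule t'(1) eval_If_True eval_straight eval_Calls t(1) | (simp; fail))+
    using t(2) t'(2) Cons.prems size
    by (simp add: algebra_simps)
qed

lemma val_size_overtime_rate_less:
  "T \<in> set Ts \<Longrightarrow> val_size (enc_rat (overtime_rate T)) < val_size (enc_list enc_mach_type Ts)"
  by (induction Ts) (auto simp: enc_mach_type_def)

text \<open>Returning the rate with the index avoids looking it up again. Every returned rate is an
  unchanged input entry, so numbers do not grow along the recursion; only the temporary cross
  products are longer.\<close>

lemma eval_cheapest:
  assumes "Ts \<noteq> []" "val_size (enc_list enc_mach_type Ts) \<le> B"
  shows "\<exists>t \<le> length Ts * (200 * B).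
    eval single_machine_program [enc_list enc_mach_type Ts] cheapest_body
      (VPair (enc_nat (cheapest Ts)) (enc_rat (overtime_rate (Ts ! cheapest Ts)))) t"
  using assms
proof (induction Ts rule: cheapest.induct)
  case (1 T U Ts)
  define i where "i = cheapest (U # Ts)"
  define R where "R = overtime_rate ((U # Ts) ! i)"
  obtain t where t: "eval single_machine_program [enc_list enc_mach_type (U # Ts)] cheapest_body
      (VPair (enc_nat i) (enc_rat R)) t"
    "t \<le> length (U # Ts) * (200 * B)"
    using 1 by (auto simp: i_def R_def)
  obtain a b where ab: "quotient_of R = (a, b)" by force
  obtain c d where cd: "quotient_of (overtime_rate T) = (c, d)" by force
  have encR: "enc_rat R = VPair (VInt a) (VInt b)" and
    encT: "enc_rat (overtime_rate T) = VPair (VInt c) (VInt d)"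
    by (simp_all add: enc_rat_def ab cd)
  \<comment> \<open>Cross multiplication keeps the direction, as \<open>quotient_of\<close> yields
    positive denominators.\<close>
  have less: "R < overtime_rate T \<longleftrightarrow> a * d < b * c"
    by (simp add: rat_less_code ab cd mult.commute[of b])
  have i: "i < length (U # Ts)"
    using cheapest_less[of "U # Ts"] by (simp add: i_def)
  have "int i + 1 \<le> int B"
    using i length_less_val_size_enc_list[of "T # U # Ts" enc_mach_type] 1(3) by simp
  then have size_i: "val_size (VInt (int i)) \<le> 1 + B" "val_size (VInt (int i + 1)) \<le> 1 + B"
    using val_size_le_abs[of "int i"] val_size_le_abs[of "int i + 1"]
    by (simp_all del: val_size.simps)
  have size_R: "val_size (enc_rat R) \<le> B"
    using val_size_overtime_rate_less[OF nth_mem[OF i]] 1(3) by (simp add: R_def)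
  have size_T: "val_size (enc_rat (overtime_rate T)) \<le> B"
    using val_size_overtime_rate_less[of T "T # U # Ts"] 1(3) by simp
  note sizes = size_i size_R size_T val_size_mult[of a d] val_size_mult[of b c]
  let ?w = "if a * d < b * c then VPair (VInt (int i + 1)) (enc_rat R)
    else VPair (VInt 0) (enc_rat (overtime_rate T))"
  have w: "VPair (enc_nat (cheapest (T # U # Ts)))
      (enc_rat (overtime_rate ((T # U # Ts) ! cheapest (T # U # Ts)))) = ?w"
    by (simp add: less[symmetric] enc_nat_def Let_def R_def i_def add.commute)
  show ?case
  proof (cases "a * d < b * c")
    case True
    show ?thesis
      unfolding w if_P[OF True]
      apply (subst cheapest_body_def)
      unfolding enc_list.simps(2) enc_mach_type_def[of T] encR encT
      apply (rule eval_leI)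
       apply (rule eval_If_True eval_straight eval_Calls
            t(1)[unfolded enc_list.simps(2) encR enc_nat_def] | (simp add: True; fail))+
      using t(2) sizes 1(3) unfolding encR encT
      by (simp add: True enc_mach_type_def[of T] encT del: val_size.simps(1))
  next
    case False
    show ?thesis
      unfolding w if_not_P[OF False]
      apply (subst cheapest_body_def)
      unfolding enc_list.simps(2) enc_mach_type_def[of T] encR encT
      apply (rule eval_leI)
       \<comment> \<open>The outer test for a nonempty tail succeeds while the inner comparison
         fails, so the outer conditional is resolved first.\<close>
       apply (rule eval_If_True, rule eval_straight)
       apply (rule eval_If_False eval_straight eval_Calls
            t(1)[unfolded enc_list.simps(2) encR enc_nat_def] | (simp add: False; fail))+
      using t(2) sizes 1(3) unfolding encR encT
      by (simp add: False enc_mach_type_def[of T] encT del: val_size.simps(1))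
  qed
next
  case ("2_2" T)
  show ?case
    unfolding cheapest_body_def enc_list.simps
    unfolding enc_mach_type_def cheapest.simps enc_nat_def nth_Cons_0 of_nat_0
    apply (rule eval_leI)
     apply (rule eval_If_False eval_straight | (simp; fail))+
    using "2_2" by (simp add: enc_mach_type_def)
qed auto

lemma runs_single_machine_program:
  assumes "valid_instance I"
  shows "\<exists>t \<le> 400 * (encoding_length I + 2) ^ 3.
    runs single_machine_program (enc_instance I) (enc_solution (single_machine I)) t"
proof -
  let ?Ts = "mach_types I" and ?Js = "jobs I"
  let ?enc_machine = "\<lambda>(i, r). VPair (enc_nat i) (enc_nat r)"
  define i where "i = cheapest ?Ts"
  define N where "N = encoding_length I"
  \<comment> \<open>The assignment repeats the type index for every job; its size is bounded by
    \<open>N * (3 + N) + 1\<close>, hence a quadratic \<open>B\<close>.\<close>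
  define B where "B = (N + 2)\<^sup>2"
  define J M where "J = enc_list enc_rat ?Js" and "M = enc_list enc_mach_type ?Ts"
  have N: "N = 1 + val_size J + val_size M"
    by (simp add: N_def J_def M_def enc_instance_def)
  have "?Ts \<noteq> []" using assms by (simp add: valid_instance_def)
  have len: "length ?Js < val_size J" "length ?Ts < val_size M"
    by (simp_all add: J_def M_def length_less_val_size_enc_list)
  have i: "i < length ?Ts"
    using \<open>?Ts \<noteq> []\<close> by (simp add: i_def cheapest_less)
  have B: "B = N * N + 4 * N + 4"
    by (simp add: B_def power2_eq_square algebra_simps)
  have size_i: "val_size (VInt (int i)) + 1 \<le> N"
    using val_size_le_abs[of "int i"] i len N by (simp del: val_size.simps)
  define C where "C = enc_list enc_nat (indicator_list (length ?Ts) (int i))"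
  have size_C: "val_size C \<le> B"
    unfolding C_def using val_size_indicator_list[of "length ?Ts" "int i"] len N B by linarith
  define A where "A = enc_list ?enc_machine (replicate (length ?Js) (i, 0))"
  have "val_size A = length ?Js * (3 + val_size (VInt (int i))) + 1"
    by (simp add: A_def val_size_replicate enc_nat_def algebra_simps)
  also have "\<dots> \<le> N * (3 + N) + 1"
    using len N size_i by (intro add_mono mult_le_mono order_refl) linarith+
  also have "\<dots> \<le> B" by (simp add: B algebra_simps)
  finally have size_A: "val_size A \<le> B" .
  define R where "R = enc_rat (overtime_rate (?Ts ! i))"
  have size_R: "val_size R \<le> B"
    using val_size_overtime_rate_less[of "?Ts ! i" ?Ts] i N B by (simp add: R_def M_def)
  obtain t1 where t1: "t1 \<le> length ?Ts * (200 * B)"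
    "eval single_machine_program [M] cheapest_body (VPair (VInt (int i)) R) t1"
    using eval_cheapest[OF \<open>?Ts \<noteq> []\<close>, of B] N B by (auto simp: M_def i_def R_def enc_nat_def)
  obtain t2 where t2: "t2 \<le> (length ?Ts + 1) * (60 * B)"
    "eval single_machine_program [VPair M (VInt (int i))] counts_body C t2"
    using eval_counts[of enc_mach_type ?Ts B "int i"] N B len i size_C by (auto simp: M_def C_def)
  have "val_size J \<le> B" "val_size (VInt (int i)) \<le> B" using N B size_i by linarith+
  then obtain t3 where t3: "t3 \<le> (length ?Js + 1) * (40 * B)"
    "eval single_machine_program [VPair J (VInt (int i))] assigned_body A t3"
    using eval_assigned[of enc_rat ?Js B "VInt (int i)" ?enc_machine "(i, 0)"] size_A
    by (auto simp: J_def A_def enc_nat_def simp del: val_size.simps)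
  \<comment> \<open>Each list is strictly shorter than its encoding, so even its length plus 1 is at
    most \<open>N\<close>.\<close>
  have "t1 \<le> N * (200 * B)" "t2 \<le> N * (60 * B)" "t3 \<le> N * (40 * B)"
    by (rule order_trans[OF t1(1)] order_trans[OF t2(1)] order_trans[OF t3(1)],
        use len N in \<open>intro mult_right_mono; linarith\<close>)+
  then have t: "t1 + t2 + t3 \<le> 300 * (N * B)" by linarith
  \<comment> \<open>The three calls contribute \<open>300 = 200 + 60 + 40\<close>; the term
    \<open>40 * B\<close> covers the steps of \<open>main_body\<close> itself.\<close>
  have bound: "300 * (N * B) + 40 * B \<le> 400 * (N + 2) ^ 3"
    by (simp add: B power3_eq_cube algebra_simps)
  have "\<exists>t \<le> 400 * (N + 2) ^ 3.
      eval single_machine_program [VPair J M] (Call 0 (Var 0)) (VPair C A) t"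
    apply (rule eval_leI)
     apply (rule eval_straight eval_Calls)+
      apply (subst main_body_def)
      apply (rule eval_straight eval_Calls t1 t2 t3)+
    apply (rule order_trans[OF _ bound])
    using t N B size_i size_C size_A size_R
    by (simp del: val_size.simps(1))
  moreover have "enc_solution (single_machine I) = VPair C A"
    by (simp add: enc_solution_def single_machine_def C_def A_def i_def Let_def)
  moreover have "enc_instance I = VPair J M"
    by (simp add: enc_instance_def J_def M_def)
  ultimately show ?thesis
    by (simp add: runs_def N_def)
qed

theorem theorem4:
  shows "\<exists>(g :: real \<Rightarrow> real) (q :: real poly poly). \<forall>\<epsilon> :: real. \<epsilon> > 0 \<longrightarrow>
    (\<exists>A :: program. \<forall>I :: packing_instance.
       valid_instance I \<and> Max (fixed_cost ` set (mach_types I)) = 1 \<longrightarrow>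
       (\<exists>S t. runs A (enc_instance I) (enc_solution S) t \<and>
          feasible I S \<and>
          real_of_rat (cost I S) \<le> (1 + \<epsilon>) * real_of_rat (cost I (opt I)) + g (1 / \<epsilon>) \<and>
          real t \<le> poly (poly q [:1 / \<epsilon>:]) (real (encoding_length I))))"
\<comment> \<open>The outer polynomial is constant in \<open>1 / \<epsilon>\<close>; its only
  coefficient is \<open>400 * (x + 2) ^ 3\<close>, with \<open>x\<close> the encoding
  length.\<close>
proof (rule exI[of _ "\<lambda>_. 1"], rule exI[of _ "[:[:400:] * [:2, 1:] ^ 3:]"], intro allI impI,
    rule exI[of _ single_machine_program], intro allI impI, elim conjE)
  fix \<epsilon> :: real and I
  assume "\<epsilon> > 0" and I: "valid_instance I" and Max: "Max (fixed_cost ` set (mach_types I)) = 1"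
  let ?N = "encoding_length I"
  have "fixed_cost T \<le> 1" if "T \<in> set (mach_types I)" for T
    unfolding Max[symmetric] using that by simp
  then have "cost I (single_machine I) \<le> cost I (opt I) + 1"
    by (rule cost_single_machine[OF I])
  then have "real_of_rat (cost I (single_machine I)) \<le> real_of_rat (cost I (opt I)) + 1"
    by (metis of_rat_1 of_rat_add of_rat_less_eq)
  moreover have "0 \<le> real_of_rat (cost I (opt I))"
    using sum_jobs_le_cost[OF I feasible_opt[OF I], of 0] I
    by (force simp: valid_instance_def less_imp_le)
  \<comment> \<open>The additive guarantee already holds with factor 1; nonnegativity of the optimum
    weakens it to the factor \<open>1 + \<epsilon>\<close>.\<close>
  then have "0 \<le> \<epsilon> * real_of_rat (cost I (opt I))"
    using \<open>\<epsilon> > 0\<close> by simp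
  ultimately have cost: "real_of_rat (cost I (single_machine I)) \<le>
      (1 + \<epsilon>) * real_of_rat (cost I (opt I)) + 1"
    by (simp add: algebra_simps)
  obtain t where t: "t \<le> 400 * (?N + 2) ^ 3"
    "runs single_machine_program (enc_instance I) (enc_solution (single_machine I)) t"
    using runs_single_machine_program[OF I] by blast
  have "real t \<le> 400 * (real ?N + 2) ^ 3"
    using of_nat_mono[OF t(1), where 'a = real] by (simp add: add.commute)
  also have "\<dots> = poly (poly [:[:400:] * [:2, 1:] ^ 3:] [:1 / \<epsilon>:]) (real ?N)"
    by (simp add: add.commute)
  finally show "\<exists>S t. runs single_machine_program (enc_instance I) (enc_solution S) t \<and>
      feasible I S \<and>
      real_of_rat (cost I S) \<le> (1 + \<epsilon>) * real_of_rat (cost I (opt I)) + 1 \<and>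
      real t \<le> poly (poly [:[:400:] * [:2, 1:] ^ 3:] [:1 / \<epsilon>:]) (real ?N)"
    using t(2) feasible_single_machine[OF I] cost by blast
qed

end
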